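(* Let $f:\mathbb{R}^n\to\mathbb{R}$ be an $m_f$-strongly convex function (with $m_f>0$) whose gradient $\nabla f$ is $L_f$-Lipschitz continuous, let $g:\mathbb{R}^n\to\mathbb{R}$ be a proper, closed, and convex (not necessarily differentiable) function, and let $\mu\in(0,2/L_f)$. Set $\sigma=\max\{|1-\mu m_f|,\,|1-\mu L_f|\}<1$. Consider the Douglas-Rachford splitting dynamics $$\dot z\;=\;-z+R_{\mu g}\bigl(R_{\mu f}(z)\bigr),$$ and let $z^\star$ be its equilibrium point. Then $z^\star$ is globally $\rho$-exponentially stable, i.e., there exist $c>0$ and $\rho\in(0,1-\sigma)$ such that every solution $z(t)$ of the dynamics satisfies $$\|z(t)-z^\star\|\;\le\; c\,\mathrm{e}^{-\rho t}\,\|z(0)-z^\star\|,\qquad\forall\, t\ge 0.$$ Moreover, $x^\star=\mathrm{prox}_{\mu f}(z^\star)$ is the optimal solution of the problem $\min_{x\in\mathbb{R}^n}\; f(x)+g(x)$.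
   Context: For a proper, closed, convex function $h$ on $\mathbb{R}^n$ and a parameter $\mu>0$, the proximal operator is the single-valued map $$\mathrm{prox}_{\mu h}(v):=\operatorname*{argmin}_{z}\Bigl(h(z)+\tfrac{1}{2\mu}\|z-v\|_2^2\Bigr),$$ and the reflected proximal operator is $R_{\mu h}(z):=2\,\mathrm{prox}_{\mu h}(z)-z$. A differentiable function $f$ is $m_f$-strongly convex if $f(\hat x)\ge f(x)+\langle\nabla f(x),\hat x-x\rangle+\frac{m_f}{2}\|\hat x-x\|_2^2$ for all $x,\hat x$. $\|\cdot\|$ is the Euclidean norm. The equilibrium point $z^\star$ is the point at which the right-hand side of the dynamics vanishes. The constants $c$ and $\rho$ do not depend on the solution (i.e., on the initial condition). *)

theory Defs
  imports "HOL-Analysis.Analysis"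
begin

text \<open>
  Convex functions take values in the extended reals (so that, for instance, indicator
  functions of convex sets are covered); a real-valued \<open>h\<close> is embedded as \<open>\<lambda>x. ereal (h x)\<close>.
\<close>

definition proper_fun :: "('a \<Rightarrow> ereal) \<Rightarrow> bool" where
  "proper_fun h \<longleftrightarrow> (\<forall>x. h x \<noteq> -\<infinity>) \<and> (\<exists>x. h x \<noteq> \<infinity>)"

definition closed_fun :: "('a::topological_space \<Rightarrow> ereal) \<Rightarrow> bool" where
  "closed_fun h \<longleftrightarrow> closed {(x, t::real). h x \<le> ereal t}"

text \<open>
  Only used together with \<^const>\<open>proper_fun\<close>, so the sum on the right is never
  \<open>\<infinity> - \<infinity>\<close>; the end points are harmless since \<open>0 * \<infinity> = 0\<close> in \<^typ>\<open>ereal\<close>.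
\<close>

definition convex_fun :: "('a::real_vector \<Rightarrow> ereal) \<Rightarrow> bool" where
  "convex_fun h \<longleftrightarrow>
    (\<forall>x y. \<forall>u\<in>{0..1}.
      h ((1 - u) *\<^sub>R x + u *\<^sub>R y) \<le> ereal (1 - u) * h x + ereal u * h y)"

lemma proper_fun_ereal: "proper_fun (\<lambda>x. ereal (g x))"
  by (simp add: proper_fun_def)

lemma convex_fun_ereal_iff: "convex_fun (\<lambda>x. ereal (g x)) \<longleftrightarrow> convex_on UNIV g"
proof
  assume "convex_fun (\<lambda>x. ereal (g x))"
  then show "convex_on UNIV g"
    by (intro convex_onI) (simp_all add: convex_fun_def)
next
  assume "convex_on UNIV g"
  then show "convex_fun (\<lambda>x. ereal (g x))"
    unfolding convex_fun_def using convex_onD[of UNIV g] by simp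
qed

lemma closed_fun_ereal:
  fixes g :: "'a::euclidean_space \<Rightarrow> real"
  assumes "convex_on UNIV g"
  shows "closed_fun (\<lambda>x. ereal (g x))"
proof -
  have "continuous_on UNIV g"
    using convex_on_continuous[OF open_UNIV assms] .
  then have "continuous_on UNIV (\<lambda>p :: 'a \<times> real. g (fst p))"
    by (rule continuous_on_compose2) (simp_all add: continuous_on_fst)
  then have "closed {p :: 'a \<times> real. g (fst p) \<le> snd p}"
    using continuous_on_snd[OF continuous_on_id] by (rule closed_Collect_le)
  then show ?thesis
    by (simp add: closed_fun_def case_prod_unfold)
qed

definition gradient :: "('a::real_inner \<Rightarrow> real) \<Rightarrow> 'a \<Rightarrow> 'a" where
  "gradient f x = (THE D. GDERIV f x :> D)"

definition strongly_convex :: "real \<Rightarrow> ('a::real_inner \<Rightarrow> real) \<Rightarrow> bool" where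
  "strongly_convex m f \<longleftrightarrow>
    (\<forall>x. f differentiable (at x)) \<and>
    (\<forall>x y. f y \<ge> f x + gradient f x \<bullet> (y - x) + m / 2 * (norm (y - x))\<^sup>2)"

text \<open>For proper, closed, convex \<open>h\<close> and \<open>\<mu> > 0\<close> the minimizer exists and is unique.\<close>

definition prox :: "real \<Rightarrow> ('a::real_normed_vector \<Rightarrow> ereal) \<Rightarrow> 'a \<Rightarrow> 'a" where
  "prox \<mu> h v =
    arg_min (\<lambda>z. h z + ereal (1 / (2 * \<mu>) * (norm (z - v))\<^sup>2)) (\<lambda>_. True)"

definition refl_prox :: "real \<Rightarrow> ('a::real_normed_vector \<Rightarrow> ereal) \<Rightarrow> 'a \<Rightarrow> 'a" where
  "refl_prox \<mu> h z = 2 *\<^sub>R prox \<mu> h z - z"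

definition DR_field ::
  "real \<Rightarrow> ('a::real_normed_vector \<Rightarrow> real) \<Rightarrow> ('a \<Rightarrow> ereal) \<Rightarrow> 'a \<Rightarrow> 'a" where
  "DR_field \<mu> f g z = - z + refl_prox \<mu> g (refl_prox \<mu> (\<lambda>x. ereal (f x)) z)"

definition is_solution ::
  "('a::real_normed_vector \<Rightarrow> 'a) \<Rightarrow> (real \<Rightarrow> 'a) \<Rightarrow> bool" where
  "is_solution F z \<longleftrightarrow>
    (\<forall>t\<ge>0. (z has_vector_derivative F (z t)) (at t within {0..}))"

end

theory Submission
  imports Defs
begin

text \<open>
  Write \<open>x = prox\<^bsub>\<mu>f\<^esub>(z)\<close>, so that \<open>z = x + \<mu> \<nabla>f(x)\<close> and \<open>R\<^bsub>\<mu>f\<^esub>(z) = x - \<mu> \<nabla>f(x)\<close>.  For two points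
  the squared distances of these two expressions differ by \<open>4 \<mu> \<langle>\<Delta>x, \<Delta>\<nabla>f\<rangle> \<ge> 4 \<mu> m \<parallel>\<Delta>x\<parallel>\<^sup>2\<close>, while
  \<open>\<parallel>\<Delta>z\<parallel> \<le> (1 + \<mu> L) \<parallel>\<Delta>x\<parallel>\<close>; hence \<open>R\<^bsub>\<mu>f\<^esub>\<close> is a contraction.  Monotonicity of the subdifferential makes
  \<open>R\<^bsub>\<mu>g\<^esub>\<close> nonexpansive, so the field is \<open>T - id\<close> with \<open>T\<close> a contraction: Banach's theorem gives the
  equilibrium, and \<open>\<parallel>z(t) - z\<^sup>\<star>\<parallel>\<^sup>2\<close> decays exponentially.  As the rate is only asked to be some element of
  \<open>(0, 1 - \<sigma>)\<close>, it may be decreased to lie in this interval.  At the equilibrium, the optimality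
  conditions of the two proximal steps say that \<open>x\<^sup>\<star>\<close> has opposite (sub)gradients for \<open>f\<close> and \<open>g\<close>.
\<close>

section \<open>Subgradients and the proximal operator\<close>

text \<open>
  Quantifying over the epigraph avoids extended-real arithmetic.
\<close>

definition subgradient :: "('a::real_inner \<Rightarrow> ereal) \<Rightarrow> 'a \<Rightarrow> 'a \<Rightarrow> bool" where
  "subgradient h p s \<longleftrightarrow>
    (\<exists>r. h p = ereal r \<and> (\<forall>z t. h z \<le> ereal t \<longrightarrow> r + s \<bullet> (z - p) \<le> t))"

section \<open>Existence of the proximal minimizer\<close>

lemma convex_funD_epigraph:
  assumes "convex_fun h" "h x \<le> ereal a" "h y \<le> ereal b" "0 \<le> u" "u \<le> 1"
  shows "h ((1 - u) *\<^sub>R x + u *\<^sub>R y) \<le> ereal ((1 - u) * a + u * b)"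
proof -
  have "h ((1 - u) *\<^sub>R x + u *\<^sub>R y) \<le> ereal (1 - u) * h x + ereal u * h y"
    using assms unfolding convex_fun_def by auto
  also have "\<dots> \<le> ereal (1 - u) * ereal a + ereal u * ereal b"
    using assms by (intro add_mono ereal_mult_left_mono) auto
  finally show ?thesis by simp
qed

text \<open>A closed epigraph means lower semicontinuity: points of \<open>K\<close> with values
  tending to -\<infinity> would accumulate at some \<open>l\<close> with value -\<infinity>, which
  \<open>fin\<close> excludes.\<close>

lemma closed_fun_bounded_below_on_compact:
  fixes h :: "'a::metric_space \<Rightarrow> ereal"
  assumes cl: "closed_fun h" and fin: "\<And>x. h x \<noteq> -\<infinity>" and K: "compact K"
  shows "\<exists>M. \<forall>x\<in>K. \<forall>t. h x \<le> ereal t \<longrightarrow> M \<le> t"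
proof (rule ccontr)
  assume "\<nexists>M. \<forall>x\<in>K. \<forall>t. h x \<le> ereal t \<longrightarrow> M \<le> t"
  then have "\<forall>n::nat. \<exists>x\<in>K. \<exists>t. h x \<le> ereal t \<and> t < - real n"
    by (meson not_le)
  then have "\<forall>n::nat. \<exists>x\<in>K. h x \<le> ereal (- real n)"
    by (meson ereal_less_eq(3) less_imp_le order_trans)
  then obtain x where x: "\<And>n::nat. x n \<in> K" "\<And>n. h (x n) \<le> ereal (- real n)"
    by metis
  obtain l r where l: "l \<in> K" and r: "strict_mono (r :: nat \<Rightarrow> nat)" and lim: "(x \<circ> r) \<longlonglongrightarrow> l"
    using K x(1) unfolding compact_def by blast
  have le: "h l \<le> ereal (- real N)" for N
  proof -
    \<comment> \<open>At the fixed height \<open>- real N\<close> these points lie in the epigraph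
      from index \<open>N\<close> on, because \<open>r n\<close> is at least \<open>n\<close>;
      closedness then covers the limit.\<close>
    have lim': "(\<lambda>n. (x (r n), - real N)) \<longlonglongrightarrow> (l, - real N)"
      using lim by (intro tendsto_Pair) (auto simp: o_def)
    have "\<forall>\<^sub>F n in sequentially. (x (r n), - real N) \<in> {(x, t::real). h x \<le> ereal t}"
      using eventually_ge_at_top[of N]
    proof eventually_elim
      case (elim n)
      have "N \<le> r n" using seq_suble[OF r, of n] elim by linarith
      then have "ereal (- real (r n)) \<le> ereal (- real N)" by simp
      then show ?case using order_trans[OF x(2)] by auto
    qed
    from Lim_in_closed_set[OF cl[unfolded closed_fun_def] this _ lim'] show ?thesis by simp
  qed
  have "h l \<noteq> \<infinity>" using le[of 0] by auto
  with fin[of l] obtain c where c: "h l = ereal c" by (cases "h l") auto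
  obtain N where "- c < real N" using reals_Archimedean2 by blast
  with le[of N] c show False by simp
qed

text \<open>Convexity along segments from \<open>x0\<close> spreads the bound \<open>M\<close> on
  the unit ball to the whole space at a linear loss; no separating hyperplane is involved.\<close>

lemma closed_convex_fun_linear_lower_bound:
  fixes h :: "'a::euclidean_space \<Rightarrow> ereal"
  assumes h: "proper_fun h" "closed_fun h" "convex_fun h"
  shows "\<exists>a b. 0 \<le> b \<and> (\<forall>x t. h x \<le> ereal t \<longrightarrow> - a - b * norm (x - v) \<le> t)"
proof -
  have fin: "h x \<noteq> -\<infinity>" for x using h(1) by (auto simp: proper_fun_def)
  obtain x0 where "h x0 \<noteq> \<infinity>" using h(1) by (auto simp: proper_fun_def)
  with fin obtain c where c: "h x0 = ereal c" by (cases "h x0") auto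
  obtain M where M: "\<And>x t. x \<in> cball x0 1 \<Longrightarrow> h x \<le> ereal t \<Longrightarrow> M \<le> t"
    using closed_fun_bounded_below_on_compact[OF h(2) fin compact_cball] by blast
  define b where "b = \<bar>M\<bar> + \<bar>c\<bar>"
  have "- b - b * norm (x - x0) \<le> t" if ht: "h x \<le> ereal t" for x t
  proof (cases "norm (x - x0) \<le> 1")
    case True
    then have "M \<le> t" using M[of x t] ht by (simp add: dist_norm norm_minus_commute)
    moreover have "0 \<le> b * norm (x - x0)" by (simp add: b_def)
    ultimately show ?thesis unfolding b_def by linarith
  next
    case False
    define d where "d = norm (x - x0)"
    have d: "d > 1" using False by (simp add: d_def)
    \<comment> \<open>The point of the segment from \<open>x0\<close> to \<open>x\<close> at
      distance 1 from \<open>x0\<close>; solving the convexity inequality there for \<open>t\<close>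
      bounds \<open>t\<close> from below.\<close>
    define y where "y = (1 - 1/d) *\<^sub>R x0 + (1/d) *\<^sub>R x"
    have "y - x0 = (1/d) *\<^sub>R (x - x0)" by (simp add: y_def algebra_simps)
    then have "norm (y - x0) = 1" using d by (simp add: d_def[symmetric])
    then have "y \<in> cball x0 1" by (simp add: dist_norm norm_minus_commute)
    moreover have "h y \<le> ereal ((1 - 1/d) * c + 1/d * t)"
      unfolding y_def using c ht d by (intro convex_funD_epigraph[OF h(3)]) auto
    ultimately have "M \<le> (1 - 1/d) * c + 1/d * t" using M by blast
    then have "d * M \<le> d * ((1 - 1/d) * c + 1/d * t)"
      using d by (intro mult_left_mono) auto
    also have "\<dots> = d * c - c + t" using d by (simp add: field_simps)
    finally have 1: "d * M - d * c + c \<le> t" by simp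
    have "d * (M - c) \<ge> d * (- b)" using d by (intro mult_left_mono) (auto simp: b_def)
    moreover have "c \<ge> - b" by (auto simp: b_def)
    ultimately show ?thesis using 1 unfolding d_def[symmetric] by (simp add: algebra_simps)
  qed
  moreover have "b * norm (x - x0) \<le> b * norm (x - v) + b * norm (v - x0)" for x
    using mult_left_mono[OF norm_triangle_ineq[of "x - v" "v - x0"], of b]
    by (simp add: b_def algebra_simps)
  ultimately have "\<forall>x t. h x \<le> ereal t \<longrightarrow> - (b + b * norm (v - x0)) - b * norm (x - v) \<le> t"
    by (smt (verit))
  moreover have "0 \<le> b" by (simp add: b_def)
  ultimately show ?thesis by blast
qed

text \<open>Minimizing over the epigraph replaces the extended-real objective by a continuous real
  function on a closed set. Quadratic growth beats the linear lower bound, so a sublevel set there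
  is compact.\<close>

lemma prox_objective_attains_min:
  fixes h :: "'a::euclidean_space \<Rightarrow> ereal"
  assumes h: "proper_fun h" "closed_fun h" "convex_fun h" and k: "0 < k"
  obtains p r where "h p = ereal r"
    "\<And>z t. h z \<le> ereal t \<Longrightarrow> r + k * (norm (p - v))\<^sup>2 \<le> t + k * (norm (z - v))\<^sup>2"
proof -
  have fin: "h x \<noteq> -\<infinity>" for x using h(1) by (auto simp: proper_fun_def)
  obtain x0 where "h x0 \<noteq> \<infinity>" using h(1) by (auto simp: proper_fun_def)
  with fin obtain c where c: "h x0 = ereal c" by (cases "h x0") auto
  obtain a b where b: "0 \<le> b" and lb: "\<And>x t. h x \<le> ereal t \<Longrightarrow> - a - b * norm (x - v) \<le> t"
    using closed_convex_fun_linear_lower_bound[OF h] by blast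
  define \<phi> where "\<phi> = (\<lambda>q :: 'a \<times> real. snd q + k * (norm (fst q - v))\<^sup>2)"
  have cont: "continuous_on A \<phi>" for A
    unfolding \<phi>_def by (intro continuous_intros)
  define C where "C = \<phi> (x0, c)"
  define S where "S = {(x, t::real). h x \<le> ereal t} \<inter> {q. \<phi> q \<le> C}"
  \<comment> \<open>For d > 1, dividing k d^2 \<le> C + a + b d by d gives the quotient; the maximum
    with 1 covers d \<le> 1.\<close>
  define D where "D = max 1 ((\<bar>C + a\<bar> + b) / k)"
  have "S \<subseteq> cball v D \<times> {- a - b * D..C}"
  proof
    fix q assume q: "q \<in> S"
    obtain x t where [simp]: "q = (x, t)" by (cases q)
    have ht: "h x \<le> ereal t" and le: "t + k * (norm (x - v))\<^sup>2 \<le> C"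
      using q by (auto simp: S_def \<phi>_def)
    define d where "d = norm (x - v)"
    have "d \<le> D"
    proof (cases "d \<le> 1")
      case False
      have "k * d\<^sup>2 \<le> C + a + b * d" using lb[OF ht] le by (simp add: d_def)
      also have "C + a \<le> \<bar>C + a\<bar> * d"
        using False mult_left_mono[of 1 d "\<bar>C + a\<bar>"] by auto
      finally have "d * (k * d) \<le> d * (\<bar>C + a\<bar> + b)"
        by (simp add: power2_eq_square algebra_simps)
      then have "k * d \<le> \<bar>C + a\<bar> + b" using False by simp
      then have "d \<le> (\<bar>C + a\<bar> + b) / k" using k by (simp add: field_simps)
      then show ?thesis by (simp add: D_def)
    qed (simp add: D_def)
    moreover have "t \<le> C" using le k by (smt (verit) mult_nonneg_nonneg zero_le_power2)
    moreover have "b * d \<le> b * D" using b \<open>d \<le> D\<close> by (rule mult_left_mono[rotated])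
    ultimately show "q \<in> cball v D \<times> {- a - b * D..C}"
      using lb[OF ht] by (simp add: d_def dist_norm norm_minus_commute)
  qed
  then have "bounded S"
    by (rule bounded_subset[rotated]) (intro bounded_Times bounded_cball bounded_closed_interval)
  moreover have "closed S"
    using h(2) unfolding S_def closed_fun_def
    by (intro closed_Int closed_Collect_le cont continuous_on_const)
  ultimately have "compact S" by (simp add: compact_eq_bounded_closed)
  moreover have x0S: "(x0, c) \<in> S" by (simp add: S_def C_def c)
  ultimately obtain q where q: "q \<in> S" "\<And>y. y \<in> S \<Longrightarrow> \<phi> q \<le> \<phi> y"
    using continuous_attains_inf[of S \<phi>] cont by blast
  obtain p r where [simp]: "q = (p, r)" by (cases q)
  have min: "r + k * (norm (p - v))\<^sup>2 \<le> t + k * (norm (z - v))\<^sup>2" if "h z \<le> ereal t" for z t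
  proof (cases "(z, t) \<in> S")
    case True
    then show ?thesis using q(2)[of "(z, t)"] by (simp add: \<phi>_def)
  next
    case False
    then have "\<phi> q \<le> \<phi> (z, t)" using that q(2)[OF x0S] by (auto simp: S_def C_def)
    then show ?thesis by (simp add: \<phi>_def)
  qed
  \<comment> \<open>The minimizing pair lies on the graph: testing it against \<open>(p, r')\<close>
    forces \<open>r\<close> = \<open>r'\<close>.\<close>
  have "h p \<le> ereal r" using q(1) by (simp add: S_def)
  with fin[of p] obtain r' where r': "h p = ereal r'" "r' \<le> r" by (cases "h p") auto
  moreover have "r \<le> r'" using min[of p r'] r' by simp
  ultimately show ?thesis using that[of p r] min by auto
qed

section \<open>Subgradient characterization of the proximal point\<close>

text \<open>Compare \<open>p\<close> with points of the segment towards \<open>z\<close>: dividing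
  by the step \<open>u\<close> and letting it tend to 0 removes the quadratic term.\<close>

lemma subgradient_if_minimizes_prox_objective:
  fixes h :: "'a::real_inner \<Rightarrow> ereal"
  assumes h: "convex_fun h" and \<mu>: "0 < \<mu>" and p: "h p = ereal r"
    and min: "\<And>z t. h z \<le> ereal t \<Longrightarrow>
      r + 1 / (2 * \<mu>) * (norm (p - v))\<^sup>2 \<le> t + 1 / (2 * \<mu>) * (norm (z - v))\<^sup>2"
  shows "subgradient h p ((1 / \<mu>) *\<^sub>R (v - p))"
proof -
  define k where "k = 1 / (2 * \<mu>)"
  have "r + ((1 / \<mu>) *\<^sub>R (v - p)) \<bullet> (z - p) \<le> t" if ht: "h z \<le> ereal t" for z t
  proof -
    define A where "A = t - r + 2 * k * ((p - v) \<bullet> (z - p))"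
    define B where "B = k * (norm (z - p))\<^sup>2"
    have "0 \<le> A + u * B" if u: "0 < u" "u \<le> 1" for u
    proof -
      define w where "w = (1 - u) *\<^sub>R p + u *\<^sub>R z"
      have "h w \<le> ereal ((1 - u) * r + u * t)"
        unfolding w_def using p ht u by (intro convex_funD_epigraph[OF h]) auto
      from min[OF this, folded k_def]
      have 1: "r + k * (norm (p - v))\<^sup>2 \<le> (1 - u) * r + u * t + k * (norm (w - v))\<^sup>2" .
      have "w - v = (p - v) + u *\<^sub>R (z - p)" by (simp add: w_def algebra_simps)
      then have "(norm (w - v))\<^sup>2 = (norm (p - v))\<^sup>2 + 2 * u * ((p - v) \<bullet> (z - p)) + u\<^sup>2 * (norm (z - p))\<^sup>2"
        by (simp only: power2_norm_eq_inner)
           (simp add: inner_add_left inner_add_right inner_commute power2_eq_square algebra_simps)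
      then have "k * (norm (w - v))\<^sup>2 = k * (norm (p - v))\<^sup>2 + u * (2 * k * ((p - v) \<bullet> (z - p)) + u * B)"
        by (simp add: B_def power2_eq_square distrib_left mult.left_commute mult.assoc)
      with 1 have "0 \<le> u * (t - r) + u * (2 * k * ((p - v) \<bullet> (z - p)) + u * B)"
        by (simp add: algebra_simps)
      then have "0 \<le> u * (A + u * B)" by (simp only: A_def distrib_left add.assoc)
      then show ?thesis using u by (simp add: zero_le_mult_iff)
    qed
    then have "\<forall>\<^sub>F u in at_right 0. 0 \<le> A + u * B"
      by (auto simp: eventually_at_right_field intro!: exI[of _ 1])
    moreover have "((\<lambda>u. A + u * B) \<longlongrightarrow> A + 0 * B) (at_right 0)"
      by (intro tendsto_intros)
    ultimately have "0 \<le> A + 0 * B"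
      by (intro tendsto_lowerbound) auto
    moreover have "2 * k * ((p - v) \<bullet> (z - p)) = - (((1 / \<mu>) *\<^sub>R (v - p)) \<bullet> (z - p))"
      using \<mu> by (simp add: k_def inner_diff_left field_simps)
    ultimately show ?thesis by (simp add: A_def)
  qed
  then show ?thesis using p by (auto simp: subgradient_def)
qed

text \<open>Expanding the square shows that the objective at \<open>z\<close> exceeds the one at
  \<open>p\<close> by at least \<open>k * (norm (z - p))\<^sup>2\<close>. So \<open>p\<close> is a
  strict minimizer and the choice in \<open>arg_min\<close> can only return it.\<close>

lemma prox_eq_if_subgradient:
  fixes h :: "'a::real_inner \<Rightarrow> ereal"
  assumes fin: "\<And>x. h x \<noteq> -\<infinity>" and \<mu>: "0 < \<mu>"
    and s: "subgradient h p ((1 / \<mu>) *\<^sub>R (v - p))"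
  shows "prox \<mu> h v = p"
proof -
  define k where "k = 1 / (2 * \<mu>)"
  define \<psi> where "\<psi> = (\<lambda>z. h z + ereal (k * (norm (z - v))\<^sup>2))"
  obtain r where r: "h p = ereal r"
    and sub: "\<And>z t. h z \<le> ereal t \<Longrightarrow> r + ((1 / \<mu>) *\<^sub>R (v - p)) \<bullet> (z - p) \<le> t"
    using s by (auto simp: subgradient_def)
  have lt: "\<psi> p < \<psi> z" if "z \<noteq> p" for z
  proof (cases "h z")
    case (real t)
    have "z - v = (z - p) - (v - p)" by simp
    then have "(norm (z - v))\<^sup>2 = (norm (z - p))\<^sup>2 - 2 * ((v - p) \<bullet> (z - p)) + (norm (p - v))\<^sup>2"
      by (simp only: power2_norm_eq_inner) (simp add: inner_diff_left inner_diff_right inner_commute)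
    then have "k * (norm (z - v))\<^sup>2 =
        k * (norm (z - p))\<^sup>2 - ((1 / \<mu>) *\<^sub>R (v - p)) \<bullet> (z - p) + k * (norm (p - v))\<^sup>2"
      using \<mu> by (simp add: k_def add_divide_distrib diff_divide_distrib)
    moreover have "0 < k * (norm (z - p))\<^sup>2" using that \<mu> by (simp add: k_def)
    ultimately show ?thesis using sub[of z t] real by (simp add: \<psi>_def r)
  qed (use fin[of z] in \<open>auto simp: \<psi>_def r\<close>)
  have "(SOME x. is_arg_min \<psi> (\<lambda>_. True) x) = p"
  proof (rule some_equality)
    show "is_arg_min \<psi> (\<lambda>_. True) p"
      unfolding is_arg_min_def using lt by (metis less_asym)
    show "x = p" if "is_arg_min \<psi> (\<lambda>_. True) x" for x
      using that lt[of x] by (auto simp: is_arg_min_def)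
  qed
  then show ?thesis by (simp add: prox_def arg_min_def \<psi>_def k_def)
qed

text \<open>Existence, necessity and sufficiency combined; every later argument about
  \<open>prox\<close> goes through this inclusion.\<close>

lemma subgradient_prox:
  fixes h :: "'a::euclidean_space \<Rightarrow> ereal"
  assumes h: "proper_fun h" "closed_fun h" "convex_fun h" and \<mu>: "0 < \<mu>"
  shows "subgradient h (prox \<mu> h v) ((1 / \<mu>) *\<^sub>R (v - prox \<mu> h v))"
proof -
  have "0 < 1 / (2 * \<mu>)" using \<mu> by simp
  from prox_objective_attains_min[OF h this, of v] obtain p r where
    "h p = ereal r"
    "\<And>z t. h z \<le> ereal t \<Longrightarrow>
      r + 1 / (2 * \<mu>) * (norm (p - v))\<^sup>2 \<le> t + 1 / (2 * \<mu>) * (norm (z - v))\<^sup>2"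
    by blast
  from subgradient_if_minimizes_prox_objective[OF h(3) \<mu> this]
  have *: "subgradient h p ((1 / \<mu>) *\<^sub>R (v - p))" .
  moreover have "prox \<mu> h v = p"
    using h(1) by (intro prox_eq_if_subgradient[OF _ \<mu> *]) (auto simp: proper_fun_def)
  ultimately show ?thesis by simp
qed

section \<open>Monotonicity and the reflected proximal operator\<close>

lemma subgradient_monotone:
  assumes "subgradient h p s" "subgradient h q t"
  shows "0 \<le> (p - q) \<bullet> (s - t)"
proof -
  obtain a b where ab: "h p = ereal a" "h q = ereal b"
    and "\<And>z t. h z \<le> ereal t \<Longrightarrow> a + s \<bullet> (z - p) \<le> t"
    and "\<And>z u. h z \<le> ereal u \<Longrightarrow> b + t \<bullet> (z - q) \<le> u"
    using assms by (auto simp: subgradient_def)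
  from this(3)[of q b] this(4)[of p a] ab
  have "a + s \<bullet> (q - p) \<le> b" "b + t \<bullet> (p - q) \<le> a" by auto
  then show ?thesis by (simp add: inner_diff_left inner_diff_right inner_commute)
qed

text \<open>The difference of reflections is 2 (p - q) - (v - w). Its squared norm is that of v - w
  minus 4 times an inner product that monotonicity makes nonnegative (firm nonexpansiveness of
  \<open>prox\<close>).\<close>

lemma refl_prox_nonexpansive:
  fixes h :: "'a::euclidean_space \<Rightarrow> ereal"
  assumes h: "proper_fun h" "closed_fun h" "convex_fun h" and \<mu>: "0 < \<mu>"
  shows "norm (refl_prox \<mu> h v - refl_prox \<mu> h w) \<le> norm (v - w)"
proof -
  define p q where "p = prox \<mu> h v" and "q = prox \<mu> h w"
  have "0 \<le> (p - q) \<bullet> ((1 / \<mu>) *\<^sub>R (v - p) - (1 / \<mu>) *\<^sub>R (w - q))"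
    unfolding p_def q_def by (rule subgradient_monotone[OF subgradient_prox subgradient_prox, OF assms assms])
  also have "\<dots> = ((p - q) \<bullet> ((v - w) - (p - q))) / \<mu>"
  proof -
    have "(1 / \<mu>) *\<^sub>R (v - p) - (1 / \<mu>) *\<^sub>R (w - q) = (1 / \<mu>) *\<^sub>R ((v - w) - (p - q))"
      by (simp add: scaleR_diff_right)
    then show ?thesis by simp
  qed
  finally have *: "0 \<le> (p - q) \<bullet> ((v - w) - (p - q))"
    using \<mu> by (simp add: zero_le_divide_iff)
  have "refl_prox \<mu> h v - refl_prox \<mu> h w = 2 *\<^sub>R (p - q) - (v - w)"
    by (simp add: refl_prox_def p_def q_def algebra_simps)
  then have "(norm (refl_prox \<mu> h v - refl_prox \<mu> h w))\<^sup>2 =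
      (norm (v - w))\<^sup>2 - 4 * ((p - q) \<bullet> ((v - w) - (p - q)))"
    by (simp only: power2_norm_eq_inner)
       (simp add: inner_diff_left inner_diff_right inner_commute algebra_simps)
  then have "(norm (refl_prox \<mu> h v - refl_prox \<mu> h w))\<^sup>2 \<le> (norm (v - w))\<^sup>2"
    using * by linarith
  then show ?thesis by (rule power2_le_imp_le) simp
qed

section \<open>Strongly convex functions\<close>

text \<open>As \<open>gradient\<close> is a definite description, a Riesz representative of the
  derivative is exhibited, \<open>adjoint F 1\<close>, and shown unique.\<close>

lemma GDERIV_gradient:
  fixes f :: "'a::euclidean_space \<Rightarrow> real"
  assumes "f differentiable (at x)"
  shows "GDERIV f x :> gradient f x"
proof -
  obtain F where F: "(f has_derivative F) (at x)" using assms by (auto simp: differentiable_def)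
  have "F = (\<lambda>y. y \<bullet> adjoint F 1)"
    using adjoint_works[OF has_derivative_linear[OF F], of _ 1] by simp
  with F have D: "GDERIV f x :> adjoint F 1" by (simp add: gderiv_def)
  moreover have "E = adjoint F 1" if "GDERIV f x :> E" for E
    using has_derivative_unique[OF that[unfolded gderiv_def] D[unfolded gderiv_def]]
    by (metis vector_eq_ldot)
  ultimately show ?thesis unfolding gradient_def by (rule theI)
qed

text \<open>Subtracting the linear function given by \<open>s\<close> leaves a function with global
  minimum at \<open>x\<close>, where its derivative vanishes.\<close>

lemma subgradient_eq_gradient:
  fixes f :: "'a::euclidean_space \<Rightarrow> real"
  assumes "f differentiable (at x)" and s: "subgradient (\<lambda>x. ereal (f x)) x s"
  shows "s = gradient f x"
proof -
  have "((\<lambda>z. f z - s \<bullet> z) has_derivative (\<lambda>y. y \<bullet> gradient f x - s \<bullet> y)) (at x)"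
    using GDERIV_gradient[OF assms(1)] unfolding gderiv_def
    by (intro has_derivative_diff) (auto intro!: derivative_eq_intros)
  moreover have "f x - s \<bullet> x \<le> f z - s \<bullet> z" for z
    using s by (auto simp: subgradient_def inner_diff_right dest!: spec[of _ z] spec[of _ "f z"])
  ultimately have "(\<lambda>y. y \<bullet> gradient f x - s \<bullet> y) = (\<lambda>y. 0)"
    by (intro differential_zero_maxmin[of x UNIV]) auto
  then have "y \<bullet> gradient f x = y \<bullet> s" for y
    by (metis eq_iff_diff_eq_0 inner_commute)
  then show ?thesis by (metis vector_eq_ldot)
qed

lemma strongly_convex_gradient_monotone:
  assumes "strongly_convex m f"
  shows "m * (norm (x - y))\<^sup>2 \<le> (x - y) \<bullet> (gradient f x - gradient f y)"
proof -
  have "f y \<ge> f x + gradient f x \<bullet> (y - x) + m / 2 * (norm (y - x))\<^sup>2"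
    "f x \<ge> f y + gradient f y \<bullet> (x - y) + m / 2 * (norm (x - y))\<^sup>2"
    using assms by (auto simp: strongly_convex_def)
  then show ?thesis
    by (simp add: norm_minus_commute[of y x] inner_diff_left inner_diff_right inner_commute)
qed

text \<open>Makes the results on \<open>prox\<close> applicable to \<open>f\<close>. The
  supporting-plane inequalities at the intermediate point are averaged, and their linear terms
  cancel.\<close>

lemma strongly_convex_imp_convex_on:
  fixes f :: "'a::real_inner \<Rightarrow> real"
  assumes f: "strongly_convex m f" and m: "0 \<le> m"
  shows "convex_on UNIV f"
proof (intro convex_onI)
  fix t :: real and x y :: 'a
  assume t: "0 < t" "t < 1"
  define w where "w = (1 - t) *\<^sub>R x + t *\<^sub>R y"
  have "f w + gradient f w \<bullet> (z - w) \<le> f z" for z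
  proof -
    have "f w + gradient f w \<bullet> (z - w) + m / 2 * (norm (z - w))\<^sup>2 \<le> f z"
      using f by (auto simp: strongly_convex_def)
    moreover have "0 \<le> m / 2 * (norm (z - w))\<^sup>2" using m by simp
    ultimately show ?thesis by linarith
  qed
  then have "(1 - t) * (f w + gradient f w \<bullet> (x - w)) + t * (f w + gradient f w \<bullet> (y - w))
      \<le> (1 - t) * f x + t * f y"
    using t by (intro add_mono mult_left_mono) auto
  moreover have "(1 - t) * (gradient f w \<bullet> (x - w)) + t * (gradient f w \<bullet> (y - w)) =
      gradient f w \<bullet> ((1 - t) *\<^sub>R (x - w) + t *\<^sub>R (y - w))"
    by (simp add: inner_add_right)
  moreover have "(1 - t) *\<^sub>R (x - w) + t *\<^sub>R (y - w) = 0"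
    by (simp add: w_def algebra_simps)
  moreover have "(1 - t) * (f w + a) + t * (f w + b) = f w + ((1 - t) * a + t * b)" for a b
    by (simp add: algebra_simps)
  ultimately have "f w \<le> (1 - t) * f x + t * f y" by simp
  then show "f ((1 - t) *\<^sub>R x + t *\<^sub>R y) \<le> (1 - t) * f x + t * f y" by (simp add: w_def)
qed simp

text \<open>The proximal step is an implicit gradient step, so a point and its reflection become
  explicit in the proximal point and the gradient there.\<close>

lemma prox_first_order_condition:
  fixes f :: "'a::euclidean_space \<Rightarrow> real"
  assumes f: "strongly_convex m f" and m: "0 \<le> m" and \<mu>: "0 < \<mu>"
  shows "z = prox \<mu> (\<lambda>x. ereal (f x)) z + \<mu> *\<^sub>R gradient f (prox \<mu> (\<lambda>x. ereal (f x)) z)"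
    (is "z = ?x + _")
proof -
  have cv: "convex_on UNIV f" by (rule strongly_convex_imp_convex_on[OF f m])
  have "subgradient (\<lambda>x. ereal (f x)) ?x ((1 / \<mu>) *\<^sub>R (z - ?x))"
    using cv \<mu>
    by (intro subgradient_prox proper_fun_ereal closed_fun_ereal) (simp_all add: convex_fun_ereal_iff)
  moreover have "f differentiable (at ?x)" using f by (simp add: strongly_convex_def)
  ultimately have "(1 / \<mu>) *\<^sub>R (z - ?x) = gradient f ?x" by (intro subgradient_eq_gradient)
  then have "\<mu> *\<^sub>R gradient f ?x = z - ?x" using \<mu> by (simp flip: \<open>_ = gradient f ?x\<close>)
  then show ?thesis by simp
qed

text \<open>Strong monotonicity and the Lipschitz bound are compared on a unit vector, which exists
  because the dimension is positive.\<close>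

lemma strong_convexity_le_lipschitz:
  fixes f :: "real ^ 'n \<Rightarrow> real"
  assumes f: "strongly_convex m f" and L: "L-lipschitz_on UNIV (gradient f)"
  shows "m \<le> L"
proof -
  obtain e :: "real ^ 'n" where e: "norm e = 1" using vector_choose_size[of 1] by auto
  have "m * (norm (e - 0))\<^sup>2 \<le> (e - 0) \<bullet> (gradient f e - gradient f 0)"
    by (rule strongly_convex_gradient_monotone[OF f])
  also have "\<dots> \<le> norm (e - 0) * norm (gradient f e - gradient f 0)"
    by (rule norm_cauchy_schwarz)
  also have "\<dots> \<le> L"
    using lipschitz_onD[OF L, of e 0] e by (simp add: dist_norm)
  finally show ?thesis using e by simp
qed

lemma refl_prox_contraction:
  fixes f :: "'a::euclidean_space \<Rightarrow> real"
  assumes f: "strongly_convex m f" and m: "0 < m" and mL: "m \<le> L"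
    and L: "L-lipschitz_on UNIV (gradient f)" and \<mu>: "0 < \<mu>"
  obtains \<kappa> where "0 \<le> \<kappa>" "\<kappa> < 1"
    "\<And>v w. norm (refl_prox \<mu> (\<lambda>x. ereal (f x)) v - refl_prox \<mu> (\<lambda>x. ereal (f x)) w) \<le> \<kappa> * norm (v - w)"
proof -
  \<comment> \<open>The guaranteed relative loss of squared distance, as a quotient of the two
    estimates; the contraction factor is \<open>sqrt (1 - q)\<close>.\<close>
  define q where "q = 4 * \<mu> * m / (1 + \<mu> * L)\<^sup>2"
  have L0: "0 < 1 + \<mu> * L" using m mL \<mu> by (simp add: add_pos_pos)
  have q0: "0 < q" using m \<mu> L0 by (simp add: q_def)
  \<comment> \<open>Together with \<open>m \<le> L\<close> this gives \<open>q \<le> 1\<close>, so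
    that the square of \<open>sqrt (1 - q)\<close> is indeed \<open>1 - q\<close>.\<close>
  have "0 \<le> (1 - \<mu> * L)\<^sup>2" by simp
  then have "4 * (\<mu> * L) \<le> (1 + \<mu> * L)\<^sup>2" by (simp add: power2_eq_square algebra_simps)
  moreover have "\<mu> * m \<le> \<mu> * L" using \<mu> mL by simp
  ultimately have q1: "q \<le> 1" using L0 by (simp add: q_def)
  let ?P = "prox \<mu> (\<lambda>x. ereal (f x))" and ?R = "refl_prox \<mu> (\<lambda>x. ereal (f x))"
  have "norm (?R v - ?R w) \<le> sqrt (1 - q) * norm (v - w)" for v w
  proof -
    define d where "d = ?P v - ?P w"
    define e where "e = gradient f (?P v) - gradient f (?P w)"
    have vw: "v - w = d + \<mu> *\<^sub>R e"
      using arg_cong2[OF prox_first_order_condition[OF f less_imp_le[OF m] \<mu>, of v]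
          prox_first_order_condition[OF f less_imp_le[OF m] \<mu>, of w], of minus]
      by (simp add: d_def e_def algebra_simps)
    have "?R v - ?R w = 2 *\<^sub>R d - (v - w)" by (simp add: refl_prox_def d_def algebra_simps)
    also have "\<dots> = d - \<mu> *\<^sub>R e" by (simp add: vw scaleR_2)
    finally have "(norm (?R v - ?R w))\<^sup>2 = (norm (v - w))\<^sup>2 - 4 * \<mu> * (d \<bullet> e)"
      unfolding vw by (simp only: power2_norm_eq_inner)
        (simp add: inner_diff_left inner_diff_right inner_add_left inner_add_right inner_commute)
    moreover have "q * (norm (v - w))\<^sup>2 \<le> 4 * \<mu> * (d \<bullet> e)"
    proof -
      have "norm (v - w) \<le> norm d + \<mu> * norm e"
        unfolding vw using norm_triangle_ineq[of d "\<mu> *\<^sub>R e"] \<mu> by simp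
      also have "norm e \<le> L * norm d"
        using lipschitz_onD[OF L, of "?P v" "?P w"] by (simp add: dist_norm d_def e_def)
      finally have "norm (v - w) \<le> (1 + \<mu> * L) * norm d"
        using \<mu> by (simp add: algebra_simps)
      then have "(norm (v - w))\<^sup>2 \<le> (1 + \<mu> * L)\<^sup>2 * (norm d)\<^sup>2"
        by (metis norm_ge_zero power_mono power_mult_distrib)
      then have "q * (norm (v - w))\<^sup>2 \<le> q * ((1 + \<mu> * L)\<^sup>2 * (norm d)\<^sup>2)"
        using q0 by simp
      also have "\<dots> = 4 * \<mu> * (m * (norm d)\<^sup>2)" using L0 by (simp add: q_def)
      also have "\<dots> \<le> 4 * \<mu> * (d \<bullet> e)"
        unfolding d_def e_def using \<mu>
        by (intro mult_left_mono strongly_convex_gradient_monotone[OF f]) auto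
      finally show ?thesis .
    qed
    ultimately have "(norm (?R v - ?R w))\<^sup>2 \<le> (1 - q) * (norm (v - w))\<^sup>2"
      by (simp add: algebra_simps)
    also have "\<dots> = (sqrt (1 - q) * norm (v - w))\<^sup>2"
      using q1 by (simp add: power_mult_distrib)
    finally show ?thesis by (rule power2_le_imp_le) (use q1 in simp)
  qed
  then show ?thesis using that[of "sqrt (1 - q)"] q0 q1 by auto
qed

section \<open>Exponential decay\<close>

text \<open>With the integrating factor \<open>exp (2 * \<rho> * s)\<close> the squared distance has
  nonpositive derivative by \<open>diss\<close>.\<close>

lemma exponential_decay_of_dissipative_field:
  fixes F :: "'a::real_inner \<Rightarrow> 'a"
  assumes diss: "\<And>x. (x - a) \<bullet> F x \<le> - \<rho> * (norm (x - a))\<^sup>2"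
    and z: "is_solution F z" and t: "0 \<le> t"
  shows "norm (z t - a) \<le> exp (- \<rho> * t) * norm (z 0 - a)"
proof -
  define \<phi> where "\<phi> s = exp (2 * \<rho> * s) * ((z s - a) \<bullet> (z s - a))" for s
  have der: "(\<phi> has_vector_derivative
      exp (2 * \<rho> * s) * (2 * \<rho> * (norm (z s - a))\<^sup>2 + 2 * ((z s - a) \<bullet> F (z s)))) (at s within {0..})"
    if "0 \<le> s" for s
  proof -
    have "(z has_derivative (\<lambda>u. u *\<^sub>R F (z s))) (at s within {0..})"
      using z that by (auto simp: is_solution_def has_vector_derivative_def)
    then show ?thesis
      unfolding \<phi>_def has_vector_derivative_def
      by (auto intro!: derivative_eq_intros
          simp: power2_norm_eq_inner inner_commute algebra_simps)
  qed
  have "\<phi> t \<le> \<phi> 0"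
  proof (rule DERIV_nonpos_imp_decreasing_open[OF t])
    \<comment> \<open>At 0 only a one-sided derivative is given. The sign is therefore checked
      inside the interval, where the derivative is two-sided, and continuity covers the end
      points.\<close>
    fix s assume s: "0 < s" "s < t"
    have "(\<phi> has_vector_derivative
      exp (2 * \<rho> * s) * (2 * \<rho> * (norm (z s - a))\<^sup>2 + 2 * ((z s - a) \<bullet> F (z s)))) (at s)"
      using der[of s] s at_within_interior[of s "{0..}"] by simp
    moreover have "exp (2 * \<rho> * s) * (2 * \<rho> * (norm (z s - a))\<^sup>2 + 2 * ((z s - a) \<bullet> F (z s))) \<le> 0"
      using diss[of "z s"] by (intro mult_nonneg_nonpos) auto
    ultimately show "\<exists>y. DERIV \<phi> s :> y \<and> y \<le> 0"
      by (auto simp: has_real_derivative_iff_has_vector_derivative)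
  next
    have "continuous_on {0..} \<phi>"
      using der by (auto simp: continuous_on_eq_continuous_within intro: has_vector_derivative_continuous)
    then show "continuous_on {0..t} \<phi>" by (rule continuous_on_subset) auto
  qed
  then have "exp (2 * \<rho> * t) * (norm (z t - a))\<^sup>2 \<le> (norm (z 0 - a))\<^sup>2"
    by (simp add: \<phi>_def power2_norm_eq_inner)
  moreover have "exp (2 * \<rho> * t) * (norm (z t - a))\<^sup>2 = (exp (\<rho> * t) * norm (z t - a))\<^sup>2"
    by (simp add: power_mult_distrib exp_double[symmetric] mult.assoc)
  ultimately have "(exp (\<rho> * t) * norm (z t - a))\<^sup>2 \<le> (norm (z 0 - a))\<^sup>2" by simp
  then have "exp (\<rho> * t) * norm (z t - a) \<le> norm (z 0 - a)"
    by (rule power2_le_imp_le) simp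
  then show ?thesis by (simp add: exp_minus field_simps)
qed

section \<open>Optimality and the Douglas-Rachford dynamics\<close>

text \<open>The linear terms of \<open>f\<close> and \<open>g\<close> at \<open>x\<close> cancel,
  and the quadratic term of strong convexity makes every other point strictly worse.\<close>

lemma minimizer_if_opposite_subgradients:
  assumes f: "strongly_convex m f" and m: "0 < m"
    and g: "subgradient g x (- gradient f x)" and fin: "\<And>x. g x \<noteq> -\<infinity>"
  shows "is_arg_min (\<lambda>x. ereal (f x) + g x) (\<lambda>_. True) y \<longleftrightarrow> y = x"
proof -
  obtain r where r: "g x = ereal r"
    and sub: "\<And>z t. g z \<le> ereal t \<Longrightarrow> r + (- gradient f x) \<bullet> (z - x) \<le> t"
    using g by (auto simp: subgradient_def)
  have "ereal (f x) + g x < ereal (f z) + g z" if "z \<noteq> x" for z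
  proof (cases "g z")
    case (real t)
    have "f z \<ge> f x + gradient f x \<bullet> (z - x) + m / 2 * (norm (z - x))\<^sup>2"
      using f by (auto simp: strongly_convex_def)
    moreover have "0 < m / 2 * (norm (z - x))\<^sup>2" using that m by simp
    ultimately show ?thesis using sub[of z t] real by (simp add: r)
  qed (use fin[of z] in \<open>auto simp: r\<close>)
  then show ?thesis unfolding is_arg_min_def by (metis less_asym)
qed

theorem theorem6:
  fixes f :: "real ^ 'n \<Rightarrow> real" and g :: "real ^ 'n \<Rightarrow> ereal"
    and m\<^sub>f L\<^sub>f \<mu> \<sigma> :: real
  assumes "m\<^sub>f > 0" and "strongly_convex m\<^sub>f f"
    and "L\<^sub>f-lipschitz_on UNIV (gradient f)"
    and "proper_fun g" and "closed_fun g" and "convex_fun g"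
    and "\<mu> \<in> {0<..<2 / L\<^sub>f}"
    and "\<sigma> = max \<bar>1 - \<mu> * m\<^sub>f\<bar> \<bar>1 - \<mu> * L\<^sub>f\<bar>"
  shows "\<sigma> < 1 \<and>
    (\<exists>!zs. DR_field \<mu> f g zs = 0) \<and>
    (\<forall>zs. DR_field \<mu> f g zs = 0 \<longrightarrow>
      (\<exists>c>0. \<exists>\<rho>\<in>{0<..<1 - \<sigma>}. \<forall>z. is_solution (DR_field \<mu> f g) z \<longrightarrow>
        (\<forall>t\<ge>0. norm (z t - zs) \<le> c * exp (- \<rho> * t) * norm (z 0 - zs))) \<and>
      (\<forall>x. is_arg_min (\<lambda>x. ereal (f x) + g x) (\<lambda>_. True) x
        \<longleftrightarrow> x = prox \<mu> (\<lambda>x. ereal (f x)) zs))"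
proof -
  let ?Rf = "refl_prox \<mu> (\<lambda>x. ereal (f x))" and ?Rg = "refl_prox \<mu> g"
  have \<mu>: "0 < \<mu>" using assms(7) by simp
  have mL: "m\<^sub>f \<le> L\<^sub>f" by (rule strong_convexity_le_lipschitz[OF assms(2,3)])
  \<comment> \<open>Both products lie strictly between 0 and 2, so their distances from 1 are below
    1.\<close>
  have "0 < \<mu> * m\<^sub>f" using \<mu> assms(1) by simp
  moreover have "\<mu> * m\<^sub>f \<le> \<mu> * L\<^sub>f" using \<mu> mL by simp
  moreover have "\<mu> * L\<^sub>f < 2" using assms(1,7) mL by (simp add: field_simps)
  ultimately have \<sigma>: "\<sigma> < 1" unfolding assms(8) by linarith
  obtain \<kappa> where \<kappa>: "0 \<le> \<kappa>" "\<kappa> < 1" and Rf: "\<And>v w. norm (?Rf v - ?Rf w) \<le> \<kappa> * norm (v - w)"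
    using refl_prox_contraction[OF assms(2,1) mL assms(3) \<mu>] by blast
  define T where "T = (\<lambda>z. ?Rg (?Rf z))"
  have T: "norm (T v - T w) \<le> \<kappa> * norm (v - w)" for v w
    unfolding T_def using refl_prox_nonexpansive[OF assms(4-6) \<mu>] Rf order_trans by blast
  have field: "DR_field \<mu> f g z = T z - z" for z by (simp add: DR_field_def T_def)
  have ex1: "\<exists>!zs. DR_field \<mu> f g zs = 0"
    using banach_fix_type[OF \<kappa>, of T] T by (simp add: field dist_norm)
  have stable: "\<exists>c>0. \<exists>\<rho>\<in>{0<..<1 - \<sigma>}. \<forall>z. is_solution (DR_field \<mu> f g) z \<longrightarrow>
      (\<forall>t\<ge>0. norm (z t - zs) \<le> c * exp (- \<rho> * t) * norm (z 0 - zs))"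
    if zs: "DR_field \<mu> f g zs = 0" for zs
  proof -
    \<comment> \<open>The contraction yields decay at rate \<open>1 - \<kappa>\<close> with constant
      1; halving \<open>1 - \<sigma>\<close> keeps \<rho> strictly inside the required
      interval.\<close>
    define \<rho> where "\<rho> = min (1 - \<kappa>) ((1 - \<sigma>) / 2)"
    have \<rho>: "\<rho> \<in> {0<..<1 - \<sigma>}" using \<sigma> \<kappa> by (auto simp: \<rho>_def min_less_iff_disj)
    have "(x - zs) \<bullet> DR_field \<mu> f g x \<le> - \<rho> * (norm (x - zs))\<^sup>2" for x
    proof -
      have "DR_field \<mu> f g x = (T x - T zs) - (x - zs)" using zs by (simp add: field)
      then have "(x - zs) \<bullet> DR_field \<mu> f g x = (x - zs) \<bullet> (T x - T zs) - (norm (x - zs))\<^sup>2"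
        by (simp only: power2_norm_eq_inner inner_diff_right)
      also have "(x - zs) \<bullet> (T x - T zs) \<le> norm (x - zs) * norm (T x - T zs)"
        by (rule norm_cauchy_schwarz)
      also have "\<dots> \<le> norm (x - zs) * (\<kappa> * norm (x - zs))" by (intro mult_left_mono T) simp
      also have "\<dots> - (norm (x - zs))\<^sup>2 = - (1 - \<kappa>) * (norm (x - zs))\<^sup>2"
        by (simp add: power2_eq_square algebra_simps)
      also have "\<dots> \<le> - \<rho> * (norm (x - zs))\<^sup>2"
        by (intro mult_right_mono) (auto simp: \<rho>_def)
      finally show ?thesis by simp
    qed
    from exponential_decay_of_dissipative_field[OF this] \<rho> show ?thesis
      by (intro exI[of _ 1] conjI bexI[of _ \<rho>]) auto
  qed
  have optimal: "is_arg_min (\<lambda>x. ereal (f x) + g x) (\<lambda>_. True) y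
      \<longleftrightarrow> y = prox \<mu> (\<lambda>x. ereal (f x)) zs"
    if zs: "DR_field \<mu> f g zs = 0" for zs y
  proof (rule minimizer_if_opposite_subgradients[OF assms(2,1)])
    define x where "x = prox \<mu> (\<lambda>x. ereal (f x)) zs"
    define p where "p = prox \<mu> g (?Rf zs)"
    have grad: "zs = x + \<mu> *\<^sub>R gradient f x"
      unfolding x_def using assms(1) by (intro prox_first_order_condition[OF assms(2) _ \<mu>]) simp
    have R: "?Rf zs = 2 *\<^sub>R x - zs" by (simp add: refl_prox_def x_def)
    \<comment> \<open>At the equilibrium \<open>?Rg\<close> sends \<open>?Rf zs\<close> back to
      \<open>zs\<close>, which forces both proximal points to coincide.\<close>
    have "2 *\<^sub>R p - (2 *\<^sub>R x - zs) = zs"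
      using zs by (simp add: DR_field_def refl_prox_def[of \<mu> g] p_def R)
    then have px: "p = x" by simp
    \<comment> \<open>With \<open>p = x\<close>, the proximal step for \<open>g\<close> has
      subgradient (x - zs) / \<mu> at \<open>x\<close>, which by \<open>grad\<close> is the negative
      gradient of \<open>f\<close>.\<close>
    have "?Rf zs - x = - (\<mu> *\<^sub>R gradient f x)"
    proof -
      have "\<mu> *\<^sub>R gradient f x = zs - x" using grad by (simp add: eq_diff_eq add.commute)
      then show ?thesis by (simp add: R scaleR_2)
    qed
    then have "(1 / \<mu>) *\<^sub>R (?Rf zs - x) = - gradient f x" using \<mu> by simp
    with subgradient_prox[OF assms(4-6) \<mu>, of "?Rf zs"] px
    show "subgradient g (prox \<mu> (\<lambda>x. ereal (f x)) zs) (- gradient f (prox \<mu> (\<lambda>x. ereal (f x)) zs))"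
      by (simp add: p_def x_def)
    show "g x \<noteq> -\<infinity>" for x using assms(4) by (simp add: proper_fun_def)
  qed
  show ?thesis using \<sigma> ex1 stable optimal by blast
qed

end
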